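(* Let $E$ be a Banach lattice. (a) If $E$ fails the positive Grothendieck property, then the set of weak$^*$-null non-weakly null $E^*$-valued sequences is almost positive pointwise latticeable in $\ell_\infty(E^* )$. (b) If $E$ fails the dual positive Schur property, then the set of weak$^*$-null disjoint non-norm null $E^*$-valued sequences is almost positive pointwise latticeable in $\ell_\infty(E^* )$; and likewise the set of absolutely weak$^*$-null disjoint non-norm null $E^*$-valued sequences is almost positive pointwise latticeable in $\ell_\infty(E^* )$.
   Context: Banach lattices are real; $E^*$ is the topological dual of $E$, a Banach lattice. $E$ has the dual positive Schur property if positive disjoint weak$^*$-null sequences in $E^*$ are norm null. $E$ has the positive Grothendieck property if positive weak$^*$-null sequences in $E^*$ are weakly null. The absolute weak$^*$ topology on $E^*$ is the locally convex-solid topology generated by the seminorms $q_x(x^* ) = |x^*|(|x|)$, $x \in E$; a sequence in $E^*$ is absolutely weak$^*$-null if it converges to $0$ in this topology. A sequence $(x_j)_{j=1}^\infty$ in a Banach lattice is disjoint if $|x_j| \wedge |x_k| = 0$ for $j \neq k$. $\ell_\infty(E^* )$ is the Banach lattice of bounded $E^*$-valued sequences with the supremum norm and the pointwise ordering; $X^+$ denotes the positive cone of a Banach lattice $X$. A Banach sequence lattice is a linear subspace $X$ of $G^{\mathbb{N}}$, $G$ a Banach lattice, endowed with a complete norm that makes $X$ a Banach lattice with the pointwise ordering. A subset $B$ of a Banach sequence lattice $X$ with $B \cap X^+ \neq \emptyset$ is almost positive pointwise latticeable (in $X$) if for each positive sequence $\mathbf{x} \in B$ there exists a closed infinite dimensional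 sublattice of $X$ contained in $B \cup \{0\}$ and containing a subsequence of $\mathbf{x}$. *)

theory Defs
  imports "HOL-Analysis.Analysis" "HOL-Library.Lattice_Algebras" "HOL-Library.Function_Algebras"
begin

section \<open>Banach lattices\<close>

class banach_lattice = banach + ordered_real_vector + lattice_ab_group_add_abs +
  assumes norm_abs_mono: "\<bar>x\<bar> \<le> \<bar>y\<bar> \<Longrightarrow> norm x \<le> norm y"

instance real :: banach_lattice
  by standard auto

lemma norm_abs [simp]: "norm \<bar>x\<bar> = norm x" for x :: "'a::banach_lattice"
  by (rule antisym; rule norm_abs_mono) simp_all

lemma norm_mono_pos: "0 \<le> x \<Longrightarrow> x \<le> y \<Longrightarrow> norm x \<le> norm y" for x y :: "'a::banach_lattice"
  by (rule norm_abs_mono) (metis abs_of_nonneg order_trans)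


section \<open>The topological dual\<close>

text \<open>
  The topological dual is \<open>'a \<Rightarrow>\<^sub>L real\<close>.  We use an isomorphic copy because a lattice structure
  cannot be attached to the function space type at the single range type \<open>real\<close>.
\<close>

typedef (overloaded) 'a dual = "UNIV :: ('a::real_normed_vector \<Rightarrow>\<^sub>L real) set"
  morphisms blinfun_of_dual Dual ..

setup_lifting type_definition_dual

lift_definition dual_apply :: "'a::real_normed_vector dual \<Rightarrow> 'a \<Rightarrow> real" is blinfun_apply .

instantiation dual :: (real_normed_vector) real_normed_vector
begin

lift_definition zero_dual :: "'a dual" is 0 .
lift_definition plus_dual :: "'a dual \<Rightarrow> 'a dual \<Rightarrow> 'a dual" is "(+)" .
lift_definition minus_dual :: "'a dual \<Rightarrow> 'a dual \<Rightarrow> 'a dual" is "(-)" .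
lift_definition uminus_dual :: "'a dual \<Rightarrow> 'a dual" is uminus .
lift_definition scaleR_dual :: "real \<Rightarrow> 'a dual \<Rightarrow> 'a dual" is scaleR .
lift_definition norm_dual :: "'a dual \<Rightarrow> real" is norm .

definition sgn_dual :: "'a dual \<Rightarrow> 'a dual"
  where "sgn_dual f = scaleR (inverse (norm f)) f"

definition dist_dual :: "'a dual \<Rightarrow> 'a dual \<Rightarrow> real"
  where "dist_dual f g = norm (f - g)"

definition uniformity_dual :: "('a dual \<times> 'a dual) filter"
  where "uniformity_dual = (INF e\<in>{0<..}. principal {(f, g). dist f g < e})"

definition open_dual :: "'a dual set \<Rightarrow> bool"
  where "open_dual U = (\<forall>f\<in>U. \<forall>\<^sub>F (f', g) in uniformity. f' = f \<longrightarrow> g \<in> U)"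

instance
proof
  show "norm (f + g) \<le> norm f + norm g" for f g :: "'a dual"
    by transfer (rule norm_triangle_ineq)
qed (simp_all add: sgn_dual_def dist_dual_def uniformity_dual_def open_dual_def,
     (transfer, simp add: algebra_simps)+)

end

lemma dual_eqI: "(\<And>x. dual_apply f x = dual_apply g x) \<Longrightarrow> f = g"
  by transfer (rule blinfun_eqI)

lemma dual_apply_simps [simp]:
  "dual_apply 0 x = 0"
  "dual_apply (f + g) x = dual_apply f x + dual_apply g x"
  "dual_apply (f - g) x = dual_apply f x - dual_apply g x"
  "dual_apply (- f) x = - dual_apply f x"
  "dual_apply (c *\<^sub>R f) x = c * dual_apply f x"
  by (transfer, simp add: blinfun.bilinear_simps)+

lemma bounded_linear_dual_apply: "bounded_linear (dual_apply f)"
  by transfer (rule blinfun.bounded_linear_right)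

lemma dual_apply_linear [simp]:
  "dual_apply f 0 = 0"
  "dual_apply f (x + y) = dual_apply f x + dual_apply f y"
  "dual_apply f (x - y) = dual_apply f x - dual_apply f y"
  "dual_apply f (- x) = - dual_apply f x"
  "dual_apply f (c *\<^sub>R x) = c * dual_apply f x"
  using linear_simps[OF bounded_linear_dual_apply[of f]]
  by (simp_all add: linear_simps[OF bounded_linear_dual_apply[of f]])

lemma dual_apply_le_norm: "\<bar>dual_apply f x\<bar> \<le> norm f * norm x"
  by transfer (metis norm_blinfun real_norm_def)

lemma norm_dual_bound: "0 \<le> b \<Longrightarrow> (\<And>x. \<bar>dual_apply f x\<bar> \<le> b * norm x) \<Longrightarrow> norm f \<le> b"
  by transfer (rule norm_blinfun_bound, auto)

lemma dual_of_bounded_linear: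
  assumes "bounded_linear F"
  shows "dual_apply (Dual (Blinfun F)) = F"
  by (simp add: dual_apply_def Dual_inverse bounded_linear_Blinfun_apply[OF assms])

lemma dist_blinfun_of_dual: "dist (blinfun_of_dual f) (blinfun_of_dual g) = dist f g"
  unfolding dist_dual_def dist_norm by transfer simp

instance dual :: (real_normed_vector) banach
proof
  fix X :: "nat \<Rightarrow> 'a dual"
  assume "Cauchy X"
  then have "Cauchy (\<lambda>n. blinfun_of_dual (X n))"
    by (simp add: Cauchy_def dist_blinfun_of_dual)
  then obtain L where "(\<lambda>n. blinfun_of_dual (X n)) \<longlonglongrightarrow> L"
    using Cauchy_convergent convergent_def by blast
  then have "X \<longlonglongrightarrow> Dual L"
    by (simp add: lim_sequentially dist_blinfun_of_dual[symmetric] Dual_inverse)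
  then show "convergent X"
    by (auto simp: convergent_def)
qed


section \<open>The dual of a Banach lattice is a Banach lattice\<close>

instantiation dual :: (banach_lattice) order
begin

definition less_eq_dual :: "'a dual \<Rightarrow> 'a dual \<Rightarrow> bool"
  where "less_eq_dual f g \<longleftrightarrow> (\<forall>x\<ge>0. dual_apply f x \<le> dual_apply g x)"

definition less_dual :: "'a dual \<Rightarrow> 'a dual \<Rightarrow> bool"
  where "less_dual f g \<longleftrightarrow> f \<le> g \<and> \<not> g \<le> f"

instance
proof
  fix f g :: "'a dual"
  assume "f \<le> g" "g \<le> f"
  then have eq: "dual_apply f x = dual_apply g x" if "0 \<le> x" for x
    using that by (auto simp: less_eq_dual_def intro: antisym)
  show "f = g"
  proof (rule dual_eqI)
    fix x
    have "dual_apply f (pprt x - - nprt x) = dual_apply g (pprt x - - nprt x)"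
      unfolding dual_apply_linear(3) using eq[of "pprt x"] eq[of "- nprt x"]
      by (simp del: dual_apply_linear)
    then show "dual_apply f x = dual_apply g x"
      using prts[of x] by (simp del: dual_apply_linear)
  qed
qed (auto simp: less_eq_dual_def less_dual_def intro: order_trans)

end

text \<open>The Riesz--Kantorovich formula for the positive part of a functional.\<close>

definition riesz_pos :: "'a::banach_lattice dual \<Rightarrow> 'a \<Rightarrow> real"
  where "riesz_pos f x = (SUP y\<in>{0..x}. dual_apply f y)"

definition dual_pos :: "'a::banach_lattice dual \<Rightarrow> 'a dual"
  where "dual_pos f = Dual (Blinfun (\<lambda>x. riesz_pos f (pprt x) - riesz_pos f (pprt (- x))))"

lemma riesz_pos_bdd: "bdd_above (dual_apply f ` {0..x})" for x :: "'a::banach_lattice"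
proof (rule bdd_aboveI2)
  fix y assume "y \<in> {0..x}"
  then have "norm y \<le> norm x" by (auto intro: norm_mono_pos)
  then show "dual_apply f y \<le> norm f * norm x"
    using dual_apply_le_norm[of f y] mult_left_mono[of "norm y" "norm x" "norm f"] by simp
qed

lemma riesz_pos_upper: "0 \<le> y \<Longrightarrow> y \<le> x \<Longrightarrow> dual_apply f y \<le> riesz_pos f x"
  unfolding riesz_pos_def by (rule cSUP_upper[OF _ riesz_pos_bdd]) auto

lemma riesz_pos_least:
  "0 \<le> x \<Longrightarrow> (\<And>y. 0 \<le> y \<Longrightarrow> y \<le> x \<Longrightarrow> dual_apply f y \<le> c) \<Longrightarrow> riesz_pos f x \<le> c"
  unfolding riesz_pos_def by (rule cSUP_least) auto

lemma riesz_pos_le_norm: "0 \<le> x \<Longrightarrow> riesz_pos f x \<le> norm f * norm x"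
proof (rule riesz_pos_least)
  fix y assume "0 \<le> y" "y \<le> x"
  then have "norm y \<le> norm x" by (auto intro: norm_mono_pos)
  then show "dual_apply f y \<le> norm f * norm x"
    using dual_apply_le_norm[of f y] mult_left_mono[of "norm y" "norm x" "norm f"] by simp
qed

lemma riesz_pos_nonneg: "0 \<le> x \<Longrightarrow> 0 \<le> riesz_pos f x"
  using riesz_pos_upper[of 0 x f] by simp

lemma riesz_pos_zero [simp]: "riesz_pos f 0 = 0"
  by (simp add: riesz_pos_def)

lemma riesz_pos_add:
  assumes "0 \<le> x" "0 \<le> y"
  shows "riesz_pos f (x + y) = riesz_pos f x + riesz_pos f y"
proof (rule antisym)
  show "riesz_pos f (x + y) \<le> riesz_pos f x + riesz_pos f y"
  proof (rule riesz_pos_least)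
    fix z assume z: "0 \<le> z" "z \<le> x + y"
    have "z - inf z x = sup 0 (z - x)"
      using diff_inf_eq_sup[of z z x] by (simp add: add_sup_distrib_left)
    then have "0 \<le> z - inf z x" "z - inf z x \<le> y"
      using z assms by (simp_all add: diff_le_eq add.commute)
    then have "dual_apply f (z - inf z x) \<le> riesz_pos f y"
      by (rule riesz_pos_upper)
    moreover have "dual_apply f (inf z x) \<le> riesz_pos f x"
      using z assms by (intro riesz_pos_upper) auto
    ultimately show "dual_apply f z \<le> riesz_pos f x + riesz_pos f y"
      using dual_apply_linear(3)[of f z "inf z x"] by linarith
  qed (use assms in simp)
  have "riesz_pos f x \<le> riesz_pos f (x + y) - riesz_pos f y"
  proof (rule riesz_pos_least)
    fix u assume u: "0 \<le> u" "u \<le> x"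
    have "riesz_pos f y \<le> riesz_pos f (x + y) - dual_apply f u"
    proof (rule riesz_pos_least)
      fix v assume "0 \<le> v" "v \<le> y"
      then have "dual_apply f (u + v) \<le> riesz_pos f (x + y)"
        using u by (intro riesz_pos_upper add_mono add_nonneg_nonneg)
      then show "dual_apply f v \<le> riesz_pos f (x + y) - dual_apply f u" by simp
    qed (use assms in simp)
    then show "dual_apply f u \<le> riesz_pos f (x + y) - riesz_pos f y" by simp
  qed (use assms in simp)
  then show "riesz_pos f x + riesz_pos f y \<le> riesz_pos f (x + y)" by simp
qed

lemma riesz_pos_scale_le:
  assumes "0 \<le> x" "0 < c"
  shows "riesz_pos f (c *\<^sub>R x) \<le> c * riesz_pos f x"
proof (rule riesz_pos_least)
  fix y assume y: "0 \<le> y" "y \<le> c *\<^sub>R x"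
  then have "0 \<le> inverse c *\<^sub>R y" "inverse c *\<^sub>R y \<le> inverse c *\<^sub>R (c *\<^sub>R x)"
    using assms by (intro scaleR_nonneg_nonneg scaleR_left_mono; simp)+
  then have "dual_apply f (inverse c *\<^sub>R y) \<le> riesz_pos f x"
    using assms(2) by (intro riesz_pos_upper) simp_all
  then show "dual_apply f y \<le> c * riesz_pos f x"
    using assms by (simp add: field_simps)
qed (use assms in \<open>auto intro: scaleR_nonneg_nonneg\<close>)

lemma riesz_pos_scale:
  assumes "0 \<le> x" "0 \<le> c"
  shows "riesz_pos f (c *\<^sub>R x) = c * riesz_pos f x"
proof (cases "c = 0")
  case True
  then show ?thesis by (simp add: riesz_pos_def)
next
  case False
  then have c: "0 < c" using assms by simp
  have "riesz_pos f (inverse c *\<^sub>R (c *\<^sub>R x)) \<le> inverse c * riesz_pos f (c *\<^sub>R x)"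
    using assms c by (intro riesz_pos_scale_le scaleR_nonneg_nonneg) auto
  then have "c * riesz_pos f x \<le> riesz_pos f (c *\<^sub>R x)"
    using c by (simp add: field_simps)
  then show ?thesis using riesz_pos_scale_le[OF assms(1) c, of f] by simp
qed

lemma riesz_pos_diff:
  assumes "0 \<le> a" "0 \<le> b" "0 \<le> c" "0 \<le> d" "a - b = c - d"
  shows "riesz_pos f a - riesz_pos f b = riesz_pos f c - riesz_pos f d"
proof -
  have "a + d = c + b" using assms(5) by (simp add: algebra_simps)
  then have "riesz_pos f a + riesz_pos f d = riesz_pos f c + riesz_pos f b"
    using assms riesz_pos_add by metis
  then show ?thesis by simp
qed

lemma pprt_diff_pprt_neg: "pprt x - pprt (- x) = x" for x :: "'a::lattice_ab_group_add"
  using prts[of x] by (simp add: pprt_neg)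

lemma pprt_le_abs: "pprt x \<le> \<bar>x\<bar>" for x :: "'a::lattice_ab_group_add_abs"
  by (simp add: pprt_def abs_ge_self)

lemma bounded_linear_dual_pos:
  "bounded_linear (\<lambda>x. riesz_pos f (pprt x) - riesz_pos f (pprt (- x)))"
proof (rule bounded_linear_intro)
  let ?P = "\<lambda>x. riesz_pos f (pprt x) - riesz_pos f (pprt (- x))"
  fix x y :: 'a and c :: real
  have "?P (x + y) = riesz_pos f (pprt x + pprt y) - riesz_pos f (pprt (- x) + pprt (- y))"
  proof (rule riesz_pos_diff)
    have "pprt x + pprt y - (pprt (- x) + pprt (- y)) = (pprt x - pprt (- x)) + (pprt y - pprt (- y))"
      by (simp add: algebra_simps)
    then show "pprt (x + y) - pprt (- (x + y)) = pprt x + pprt y - (pprt (- x) + pprt (- y))"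
      by (simp only: pprt_diff_pprt_neg)
  qed simp_all
  then show "?P (x + y) = ?P x + ?P y"
    by (simp add: riesz_pos_add)
  show "?P (c *\<^sub>R x) = c *\<^sub>R ?P x"
  proof (cases "0 \<le> c")
    case True
    have "?P (c *\<^sub>R x) = riesz_pos f (c *\<^sub>R pprt x) - riesz_pos f (c *\<^sub>R pprt (- x))"
    proof (rule riesz_pos_diff)
      show "pprt (c *\<^sub>R x) - pprt (- (c *\<^sub>R x)) = c *\<^sub>R pprt x - c *\<^sub>R pprt (- x)"
        by (simp only: pprt_diff_pprt_neg scaleR_diff_right[symmetric])
    qed (use True in \<open>simp_all add: scaleR_nonneg_nonneg\<close>)
    then show ?thesis using True by (simp add: riesz_pos_scale algebra_simps)
  next
    case False
    have "?P (c *\<^sub>R x) = riesz_pos f ((- c) *\<^sub>R pprt (- x)) - riesz_pos f ((- c) *\<^sub>R pprt x)"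
    proof (rule riesz_pos_diff)
      have "(- c) *\<^sub>R pprt (- x) - (- c) *\<^sub>R pprt x = c *\<^sub>R (pprt x - pprt (- x))"
        by (simp add: algebra_simps)
      then show "pprt (c *\<^sub>R x) - pprt (- (c *\<^sub>R x)) = (- c) *\<^sub>R pprt (- x) - (- c) *\<^sub>R pprt x"
        by (simp only: pprt_diff_pprt_neg)
    qed (use False in \<open>auto intro!: scaleR_nonneg_nonneg simp del: scaleR_minus_left\<close>)
    then show ?thesis using False
      by (simp add: riesz_pos_scale algebra_simps del: scaleR_minus_left)
  qed
  have *: "riesz_pos f (pprt z) \<le> norm f * norm z" for z
  proof -
    have "norm (pprt z) \<le> norm \<bar>z\<bar>" by (intro norm_mono_pos pprt_le_abs) simp
    then show ?thesis
      using riesz_pos_le_norm[of "pprt z" f] mult_left_mono[of "norm (pprt z)" "norm z" "norm f"] by simp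
  qed
  have "0 \<le> riesz_pos f (pprt x)" "0 \<le> riesz_pos f (pprt (- x))"
    by (simp_all add: riesz_pos_nonneg)
  then show "norm (?P x) \<le> norm x * norm f"
    using *[of x] *[of "- x"] by (simp add: mult.commute abs_le_iff)
qed

lemma dual_apply_dual_pos: "0 \<le> x \<Longrightarrow> dual_apply (dual_pos f) x = riesz_pos f x"
  by (simp add: dual_pos_def dual_of_bounded_linear[OF bounded_linear_dual_pos] riesz_pos_zero)

lemma dual_pos_upper: "f \<le> dual_pos f" "0 \<le> dual_pos f"
  by (auto simp: less_eq_dual_def dual_apply_dual_pos riesz_pos_nonneg intro: riesz_pos_upper)

lemma dual_apply_mono: "0 \<le> f \<Longrightarrow> x \<le> y \<Longrightarrow> dual_apply f x \<le> dual_apply f y"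
  unfolding less_eq_dual_def using dual_apply_linear(3)[of f y x]
  by (auto dest: spec[of _ "y - x"])

lemma dual_pos_least:
  assumes "f \<le> g" "0 \<le> g"
  shows "dual_pos f \<le> g"
  unfolding less_eq_dual_def
proof (intro allI impI)
  fix x :: 'a assume x: "0 \<le> x"
  have "riesz_pos f x \<le> dual_apply g x"
  proof (rule riesz_pos_least[OF x])
    fix y assume "0 \<le> y" "y \<le> x"
    then show "dual_apply f y \<le> dual_apply g x"
      using assms(1) dual_apply_mono[OF assms(2)] unfolding less_eq_dual_def by (meson order_trans)
  qed
  then show "dual_apply (dual_pos f) x \<le> dual_apply g x"
    by (simp add: dual_apply_dual_pos x)
qed

instance dual :: (banach_lattice) ordered_real_vector
  by standard
    (auto simp: less_eq_dual_def mult_left_mono mult_right_mono)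

instantiation dual :: (banach_lattice) banach_lattice
begin

definition sup_dual :: "'a dual \<Rightarrow> 'a dual \<Rightarrow> 'a dual"
  where "sup_dual f g = g + dual_pos (f - g)"

definition inf_dual :: "'a dual \<Rightarrow> 'a dual \<Rightarrow> 'a dual"
  where "inf_dual f g = - sup (- f) (- g)"

definition abs_dual :: "'a dual \<Rightarrow> 'a dual"
  where "abs_dual f = sup f (- f)"

instance
proof
  fix f g h :: "'a dual"
  have up1: "f \<le> sup f g" for f g :: "'a dual"
    using dual_pos_upper(1)[of "f - g"] by (simp add: sup_dual_def diff_le_eq add.commute)
  have up2: "g \<le> sup f g" for f g :: "'a dual"
    using dual_pos_upper(2)[of "f - g"] by (simp add: sup_dual_def)
  have least: "sup g f \<le> h" if "g \<le> h" "f \<le> h" for f g h :: "'a dual"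
    using dual_pos_least[of "g - f" "h - f"] that
    by (simp add: sup_dual_def le_diff_eq add.commute)
  show "f \<le> sup f g" "g \<le> sup f g" "g \<le> f \<Longrightarrow> h \<le> f \<Longrightarrow> sup g h \<le> f"
    by (fact up1 up2 least)+
  show "inf f g \<le> f" "inf f g \<le> g"
    using up1[of "- f" "- g"] up2[of "- g" "- f"] by (simp_all add: inf_dual_def minus_le_iff)
  show "f \<le> inf g h" if "f \<le> g" "f \<le> h"
    using least[of "- g" "- f" "- h"] that by (simp add: inf_dual_def le_minus_iff)
  show "\<bar>f\<bar> = sup f (- f)"
    by (rule abs_dual_def)
  have ge: "\<bar>dual_apply f x\<bar> \<le> dual_apply \<bar>f\<bar> \<bar>x\<bar>" for f :: "'a dual" and x
  proof -
    have f: "f \<le> \<bar>f\<bar>" "- f \<le> \<bar>f\<bar>" unfolding abs_dual_def by (fact up1 up2)+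
    have "dual_apply f (pprt x) \<le> dual_apply \<bar>f\<bar> (pprt x)"
      "- dual_apply f (pprt x) \<le> dual_apply \<bar>f\<bar> (pprt x)"
      "dual_apply f (pprt (- x)) \<le> dual_apply \<bar>f\<bar> (pprt (- x))"
      "- dual_apply f (pprt (- x)) \<le> dual_apply \<bar>f\<bar> (pprt (- x))"
      using f unfolding less_eq_dual_def by (auto simp del: dual_apply_linear)
    moreover have "dual_apply f x = dual_apply f (pprt x) - dual_apply f (pprt (- x))"
      by (metis dual_apply_linear(3) pprt_diff_pprt_neg)
    moreover have "\<bar>x\<bar> = pprt x + pprt (- x)"
      by (simp add: abs_prts pprt_neg)
    ultimately show ?thesis by (simp del: dual_apply_linear(3,4))
  qed
  have le: "norm \<bar>f\<bar> \<le> norm f" for f :: "'a dual"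
  proof (rule norm_dual_bound)
    fix x
    have abs_ge: "0 \<le> \<bar>f\<bar>"
    proof -
      have "0 \<le> \<bar>f\<bar> + \<bar>f\<bar>"
        using add_mono[of f "\<bar>f\<bar>" "- f" "\<bar>f\<bar>"] up1[of f "- f"] up2[of "- f" f]
        by (simp add: abs_dual_def)
      then show ?thesis by (auto simp: less_eq_dual_def)
    qed
    have "\<bar>dual_apply \<bar>f\<bar> x\<bar> \<le> dual_apply \<bar>f\<bar> \<bar>x\<bar>"
      using dual_apply_mono[OF abs_ge, of x "\<bar>x\<bar>"] dual_apply_mono[OF abs_ge, of "- x" "\<bar>x\<bar>"]
      by (simp add: abs_le_iff abs_ge_self abs_ge_minus_self)
    also have "\<dots> = - dual_apply f \<bar>x\<bar> + riesz_pos (f - - f) \<bar>x\<bar>"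
      by (simp add: abs_dual_def sup_dual_def dual_apply_dual_pos)
    also have "\<dots> \<le> norm f * norm x"
    proof -
      have "riesz_pos (f - - f) \<bar>x\<bar> \<le> norm f * norm x + dual_apply f \<bar>x\<bar>"
      proof (rule riesz_pos_least)
        fix y assume y: "0 \<le> y" "y \<le> \<bar>x\<bar>"
        have "\<bar>y + y - \<bar>x\<bar>\<bar> \<le> \<bar>x\<bar>"
        proof (rule abs_leI)
          show "y + y - \<bar>x\<bar> \<le> \<bar>x\<bar>" using y by (simp add: diff_le_eq add_mono)
          show "- (y + y - \<bar>x\<bar>) \<le> \<bar>x\<bar>" using order_trans[of "- y" 0 y] y(1) by simp
        qed
        then have "norm (y + y - \<bar>x\<bar>) \<le> norm \<bar>x\<bar>"
          by (intro norm_abs_mono) simp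
        then have "dual_apply f (y + y - \<bar>x\<bar>) \<le> norm f * norm x"
          using dual_apply_le_norm[of f "y + y - \<bar>x\<bar>"]
            mult_left_mono[of "norm (y + y - \<bar>x\<bar>)" "norm x" "norm f"]
          by (simp del: dual_apply_linear)
        then show "dual_apply (f - - f) y \<le> norm f * norm x + dual_apply f \<bar>x\<bar>" by simp
      qed simp
      then show ?thesis by simp
    qed
    finally show "\<bar>dual_apply \<bar>f\<bar> x\<bar> \<le> norm f * norm x" .
  qed simp
  show "norm f \<le> norm g" if fg: "\<bar>f\<bar> \<le> \<bar>g\<bar>"
  proof (rule order_trans[OF _ le])
    show "norm f \<le> norm \<bar>g\<bar>"
    proof (rule norm_dual_bound)
      fix x :: 'a
      have "\<bar>dual_apply f x\<bar> \<le> dual_apply \<bar>f\<bar> \<bar>x\<bar>" by (rule ge)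
      also have "\<dots> \<le> dual_apply \<bar>g\<bar> \<bar>x\<bar>" using fg by (simp add: less_eq_dual_def)
      also have "\<dots> \<le> norm \<bar>g\<bar> * norm x" using dual_apply_le_norm[of "\<bar>g\<bar>" "\<bar>x\<bar>"] by simp
      finally show "\<bar>dual_apply f x\<bar> \<le> norm \<bar>g\<bar> * norm x" .
    qed simp
  qed
qed

end


section \<open>Weak, weak* and absolute weak* topologies\<close>

definition weak_topology :: "'a::real_normed_vector topology"
  where "weak_topology = pullback_topology UNIV (\<lambda>x (\<phi> :: 'a dual). dual_apply \<phi> x) euclidean"

definition weak_star_topology :: "'a::real_normed_vector dual topology"
  where "weak_star_topology = pullback_topology UNIV dual_apply euclidean"

definition abs_weak_star_seminorm :: "'a::banach_lattice \<Rightarrow> 'a dual \<Rightarrow> real"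
  where "abs_weak_star_seminorm x f = dual_apply \<bar>f\<bar> \<bar>x\<bar>"

definition abs_weak_star_topology :: "'a::banach_lattice dual topology"
  where "abs_weak_star_topology =
    topology_generated_by {{g. abs_weak_star_seminorm x (g - f) < e} | x f e. 0 < e}"

definition weakly_null :: "(nat \<Rightarrow> 'a::real_normed_vector) \<Rightarrow> bool"
  where "weakly_null u \<longleftrightarrow> limitin weak_topology u 0 sequentially"

definition weak_star_null :: "(nat \<Rightarrow> 'a::real_normed_vector dual) \<Rightarrow> bool"
  where "weak_star_null u \<longleftrightarrow> limitin weak_star_topology u 0 sequentially"

definition abs_weak_star_null :: "(nat \<Rightarrow> 'a::banach_lattice dual) \<Rightarrow> bool"
  where "abs_weak_star_null u \<longleftrightarrow> limitin abs_weak_star_topology u 0 sequentially"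

definition norm_null :: "(nat \<Rightarrow> 'a::real_normed_vector) \<Rightarrow> bool"
  where "norm_null u \<longleftrightarrow> u \<longlonglongrightarrow> 0"

lemma limitin_pullback_euclidean_iff:
  fixes F :: "'a \<Rightarrow> 'b \<Rightarrow> real"
  shows "limitin (pullback_topology UNIV F euclidean) u l sequentially \<longleftrightarrow>
    (\<forall>b. (\<lambda>n. F (u n) b) \<longlonglongrightarrow> F l b)"
proof -
  have "limitin (pullback_topology UNIV F euclidean) u l sequentially \<longleftrightarrow>
    limitin euclidean (\<lambda>n. F (u n)) (F l) sequentially"
    by (auto simp: limitin_def topspace_pullback_topology openin_pullback_topology)
  also have "\<dots> \<longleftrightarrow> (\<forall>b. (\<lambda>n. F (u n) b) \<longlonglongrightarrow> F l b)"
    unfolding euclidean_product_topology[symmetric] limitin_componentwise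
    by (simp add: topspace_product_topology)
  finally show ?thesis .
qed

lemma weakly_null_iff: "weakly_null u \<longleftrightarrow> (\<forall>\<phi>. (\<lambda>n. dual_apply \<phi> (u n)) \<longlonglongrightarrow> 0)"
  by (simp add: weakly_null_def weak_topology_def limitin_pullback_euclidean_iff)

lemma weak_star_null_iff: "weak_star_null u \<longleftrightarrow> (\<forall>x. (\<lambda>n. dual_apply (u n) x) \<longlonglongrightarrow> 0)"
  by (simp add: weak_star_null_def weak_star_topology_def limitin_pullback_euclidean_iff)

lemma abs_weak_star_seminorm_triangle:
  "abs_weak_star_seminorm x (f + g) \<le> abs_weak_star_seminorm x f + abs_weak_star_seminorm x g"
  using abs_triangle_ineq[of f g] unfolding abs_weak_star_seminorm_def
  by (simp add: less_eq_dual_def)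

lemma abs_weak_star_seminorm_nonneg: "0 \<le> abs_weak_star_seminorm x f"
  using abs_ge_zero[of f] by (simp add: abs_weak_star_seminorm_def less_eq_dual_def)

lemma abs_weak_star_null_iff:
  "abs_weak_star_null u \<longleftrightarrow> (\<forall>x. (\<lambda>n. dual_apply \<bar>u n\<bar> \<bar>x\<bar>) \<longlonglongrightarrow> 0)"
proof
  assume L: "abs_weak_star_null u"
  show "\<forall>x. (\<lambda>n. dual_apply \<bar>u n\<bar> \<bar>x\<bar>) \<longlonglongrightarrow> 0"
  proof
    fix x
    show "(\<lambda>n. dual_apply \<bar>u n\<bar> \<bar>x\<bar>) \<longlonglongrightarrow> 0"
    proof (rule tendstoI)
      fix e :: real assume e: "0 < e"
      have "openin abs_weak_star_topology {g. abs_weak_star_seminorm x (g - 0) < e}"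
        unfolding abs_weak_star_topology_def by (rule topology_generated_by_Basis) (use e in blast)
      moreover have "0 \<in> {g. abs_weak_star_seminorm x (g - 0) < e}"
        using e by (simp add: abs_weak_star_seminorm_def)
      ultimately have "\<forall>\<^sub>F n in sequentially. u n \<in> {g. abs_weak_star_seminorm x (g - 0) < e}"
        using L unfolding abs_weak_star_null_def limitin_def by blast
      then show "\<forall>\<^sub>F n in sequentially. dist (dual_apply \<bar>u n\<bar> \<bar>x\<bar>) 0 < e"
        using abs_weak_star_seminorm_nonneg[of x]
        by (auto simp: abs_weak_star_seminorm_def elim!: eventually_mono)
    qed
  qed
next
  assume R: "\<forall>x. (\<lambda>n. dual_apply \<bar>u n\<bar> \<bar>x\<bar>) \<longlonglongrightarrow> 0"
  let ?B = "{{g. abs_weak_star_seminorm x (g - f) < e} | (x :: 'a) f e. 0 < e}"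
  have gen: "generate_topology_on ?B U \<Longrightarrow> 0 \<in> U \<Longrightarrow> \<forall>\<^sub>F n in sequentially. u n \<in> U" for U
  proof (induction rule: generate_topology_on.induct)
    case Empty
    then show ?case by simp
  next
    case (Int a b)
    then show ?case by (auto elim: eventually_elim2)
  next
    case (UN K)
    then obtain k where "k \<in> K" "0 \<in> k" by blast
    with UN have "\<forall>\<^sub>F n in sequentially. u n \<in> k" by blast
    then show ?case using \<open>k \<in> K\<close> by (auto elim!: eventually_mono)
  next
    case (Basis s)
    then obtain x f e where s: "s = {g. abs_weak_star_seminorm x (g - f) < e}" by blast
    define d where "d = e - abs_weak_star_seminorm x (0 - f)"
    have "0 < d" using Basis.prems by (simp add: s d_def)
    then have "\<forall>\<^sub>F n in sequentially. dual_apply \<bar>u n\<bar> \<bar>x\<bar> < d"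
      using R by (auto intro: order_tendstoD(2))
    then show ?case
    proof eventually_elim
      case (elim n)
      then show ?case
        using abs_weak_star_seminorm_triangle[of x "u n" "0 - f"]
        by (simp add: s d_def abs_weak_star_seminorm_def)
    qed
  qed
  have "0 \<in> \<Union>?B"
    by (rule UnionI[of "{g. abs_weak_star_seminorm 0 (g - 0) < 1}"])
      (use zero_less_one in \<open>blast, simp add: abs_weak_star_seminorm_def\<close>)
  then show "abs_weak_star_null u"
    unfolding abs_weak_star_null_def limitin_def abs_weak_star_topology_def
      topology_generated_by_topspace openin_topology_generated_by_iff
    using gen by blast
qed


section \<open>Disjoint sequences and the two properties of Banach lattices\<close>

definition disjoint_seq :: "(nat \<Rightarrow> 'a::banach_lattice) \<Rightarrow> bool"
  where "disjoint_seq u \<longleftrightarrow> (\<forall>j k. j \<noteq> k \<longrightarrow> inf \<bar>u j\<bar> \<bar>u k\<bar> = 0)"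

definition positive_Grothendieck_property :: "'a::banach_lattice itself \<Rightarrow> bool"
  where "positive_Grothendieck_property _ \<longleftrightarrow>
    (\<forall>u :: nat \<Rightarrow> 'a dual. (\<forall>n. 0 \<le> u n) \<and> weak_star_null u \<longrightarrow> weakly_null u)"

definition dual_positive_Schur_property :: "'a::banach_lattice itself \<Rightarrow> bool"
  where "dual_positive_Schur_property _ \<longleftrightarrow>
    (\<forall>u :: nat \<Rightarrow> 'a dual.
      (\<forall>n. 0 \<le> u n) \<and> disjoint_seq u \<and> weak_star_null u \<longrightarrow> norm_null u)"


section \<open>Banach sequence lattices\<close>

instantiation "fun" :: (type, real_vector) real_vector
begin

definition scaleR_fun :: "real \<Rightarrow> ('a \<Rightarrow> 'b) \<Rightarrow> 'a \<Rightarrow> 'b"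
  where "scaleR_fun c f = (\<lambda>x. c *\<^sub>R f x)"

instance
  by standard (simp_all add: scaleR_fun_def fun_eq_iff algebra_simps)

end

text \<open>
  A sequence lattice is given by its carrier \<open>X\<close> and its norm \<open>N\<close>, whose values outside \<open>X\<close> are
  irrelevant.  Suprema are taken in the ordered space \<open>X\<close>; for a general \<open>X\<close> they need not be
  the pointwise suprema.
\<close>

definition sup_in :: "'b::order set \<Rightarrow> 'b \<Rightarrow> 'b \<Rightarrow> 'b \<Rightarrow> bool"
  where "sup_in X x y z \<longleftrightarrow>
    z \<in> X \<and> x \<le> z \<and> y \<le> z \<and> (\<forall>w\<in>X. x \<le> w \<and> y \<le> w \<longrightarrow> z \<le> w)"

definition norm_dist_on :: "'b::real_vector set \<Rightarrow> ('b \<Rightarrow> real) \<Rightarrow> 'b \<Rightarrow> 'b \<Rightarrow> real"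
  where "norm_dist_on X N x y = (if x \<in> X \<and> y \<in> X then N (x - y) else 0)"

definition banach_sequence_lattice ::
    "(nat \<Rightarrow> 'g::banach_lattice) set \<Rightarrow> ((nat \<Rightarrow> 'g) \<Rightarrow> real) \<Rightarrow> bool"
  where "banach_sequence_lattice X N \<longleftrightarrow>
    subspace X \<and>
    (\<forall>x\<in>X. 0 \<le> N x \<and> (N x = 0 \<longleftrightarrow> x = 0)) \<and>
    (\<forall>x\<in>X. \<forall>c. N (c *\<^sub>R x) = \<bar>c\<bar> * N x) \<and>
    (\<forall>x\<in>X. \<forall>y\<in>X. N (x + y) \<le> N x + N y) \<and>
    Metric_space.mcomplete X (norm_dist_on X N) \<and>
    (\<forall>x\<in>X. \<forall>y\<in>X. \<exists>z. sup_in X x y z) \<and>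
    (\<forall>x\<in>X. \<forall>y\<in>X. \<forall>u v. sup_in X x (- x) u \<and> sup_in X y (- y) v \<and> u \<le> v \<longrightarrow> N x \<le> N y)"

definition closed_infinite_dim_sublattice ::
    "(nat \<Rightarrow> 'g::banach_lattice) set \<Rightarrow> ((nat \<Rightarrow> 'g) \<Rightarrow> real) \<Rightarrow> (nat \<Rightarrow> 'g) set \<Rightarrow> bool"
  where "closed_infinite_dim_sublattice X N S \<longleftrightarrow>
    S \<subseteq> X \<and> subspace S \<and>
    (\<forall>x\<in>S. \<forall>y\<in>S. \<exists>z\<in>S. sup_in X x y z) \<and>
    closedin (Metric_space.mtopology X (norm_dist_on X N)) S \<and>
    \<not> (\<exists>F. finite F \<and> S \<subseteq> span F)"

definition almost_positive_pointwise_latticeable ::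
    "(nat \<Rightarrow> 'g::banach_lattice) set \<Rightarrow> ((nat \<Rightarrow> 'g) \<Rightarrow> real) \<Rightarrow> (nat \<Rightarrow> 'g) set \<Rightarrow> bool"
  where "almost_positive_pointwise_latticeable X N B \<longleftrightarrow>
    B \<subseteq> X \<and> B \<inter> {x \<in> X. 0 \<le> x} \<noteq> {} \<and>
    (\<forall>x\<in>B. 0 \<le> x \<longrightarrow>
      (\<exists>S. closed_infinite_dim_sublattice X N S \<and> S \<subseteq> B \<union> {0} \<and>
           (\<exists>r :: nat \<Rightarrow> nat. strict_mono r \<and> x \<circ> r \<in> S)))"


section \<open>Bounded sequences\<close>

definition ell_infty :: "(nat \<Rightarrow> 'g::real_normed_vector) set"
  where "ell_infty = {x. bounded (range x)}"

definition ell_infty_norm :: "(nat \<Rightarrow> 'g::real_normed_vector) \<Rightarrow> real"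
  where "ell_infty_norm x = (SUP n. norm (x n))"

lemma ell_infty_norm_upper: "x \<in> ell_infty \<Longrightarrow> norm (x n) \<le> ell_infty_norm x"
  unfolding ell_infty_def ell_infty_norm_def
  by (rule cSUP_upper) (auto simp: bounded_iff intro: bdd_aboveI2)

lemma ell_infty_norm_least: "(\<And>n. norm (x n) \<le> b) \<Longrightarrow> ell_infty_norm x \<le> b"
  unfolding ell_infty_norm_def by (rule cSUP_least) auto

lemma ell_inftyI: "(\<And>n. norm (x n) \<le> b) \<Longrightarrow> x \<in> ell_infty"
  unfolding ell_infty_def by (auto simp: bounded_iff)

lemma ell_infty_norm_nonneg: "x \<in> ell_infty \<Longrightarrow> 0 \<le> ell_infty_norm x"
  by (rule order_trans[OF norm_ge_zero ell_infty_norm_upper[of x 0]])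

lemma ell_infty_norm_eq_0: "x \<in> ell_infty \<Longrightarrow> ell_infty_norm x = 0 \<longleftrightarrow> x = 0"
proof
  assume "x \<in> ell_infty" "ell_infty_norm x = 0"
  then have "norm (x n) \<le> 0" for n using ell_infty_norm_upper[of x n] by simp
  then show "x = 0" by (auto simp: fun_eq_iff)
qed (simp add: ell_infty_norm_def)

lemma ell_infty_norm_triangle:
  assumes "x \<in> ell_infty" "y \<in> ell_infty"
  shows "ell_infty_norm (x + y) \<le> ell_infty_norm x + ell_infty_norm y"
  using ell_infty_norm_upper[OF assms(1)] ell_infty_norm_upper[OF assms(2)]
  by (intro ell_infty_norm_least) (auto intro: norm_triangle_le add_mono)

lemma subspace_ell_infty: "subspace (ell_infty :: (nat \<Rightarrow> 'g::real_normed_vector) set)"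
proof (rule subspaceI)
  fix x y :: "nat \<Rightarrow> 'g" and c :: real
  assume x: "x \<in> ell_infty"
  show "c *\<^sub>R x \<in> ell_infty"
    using ell_infty_norm_upper[OF x]
    by (intro ell_inftyI[of _ "\<bar>c\<bar> * ell_infty_norm x"]) (simp add: scaleR_fun_def mult_left_mono)
  assume y: "y \<in> ell_infty"
  show "x + y \<in> ell_infty"
    using ell_infty_norm_upper[OF x] ell_infty_norm_upper[OF y]
    by (intro ell_inftyI[of _ "ell_infty_norm x + ell_infty_norm y"])
      (auto intro: norm_triangle_le add_mono)
qed (auto intro: ell_inftyI[of _ 0])

lemma ell_infty_norm_scaleR:
  assumes x: "x \<in> ell_infty"
  shows "ell_infty_norm (c *\<^sub>R x) = \<bar>c\<bar> * ell_infty_norm x"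
proof (cases "c = 0")
  case True
  then show ?thesis by (simp add: ell_infty_norm_def)
next
  case False
  have le: "ell_infty_norm (c *\<^sub>R x) \<le> \<bar>c\<bar> * ell_infty_norm x" if "x \<in> ell_infty" for c and x :: "nat \<Rightarrow> 'a"
    using ell_infty_norm_upper[OF that]
    by (intro ell_infty_norm_least) (simp add: scaleR_fun_def mult_left_mono)
  have "c *\<^sub>R x \<in> ell_infty" using x by (rule subspace_scale[OF subspace_ell_infty])
  from le[OF this, of "inverse c"] have "\<bar>c\<bar> * ell_infty_norm x \<le> ell_infty_norm (c *\<^sub>R x)"
    using False by (simp add: field_simps abs_inverse)
  with le[OF x, of c] show ?thesis by simp
qed

lemma Metric_space_ell_infty: "Metric_space ell_infty (norm_dist_on ell_infty ell_infty_norm)"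
proof
  fix x y z :: "nat \<Rightarrow> 'a"
  have diff: "u - v \<in> ell_infty" if "u \<in> ell_infty" "v \<in> ell_infty" for u v :: "nat \<Rightarrow> 'a"
    using that by (rule subspace_diff[OF subspace_ell_infty])
  show "0 \<le> norm_dist_on ell_infty ell_infty_norm x y"
    by (simp add: norm_dist_on_def ell_infty_norm_nonneg diff)
  show "norm_dist_on ell_infty ell_infty_norm x y = norm_dist_on ell_infty ell_infty_norm y x"
    by (simp add: norm_dist_on_def ell_infty_norm_def norm_minus_commute)
  assume xy: "x \<in> ell_infty" "y \<in> ell_infty"
  then show "norm_dist_on ell_infty ell_infty_norm x y = 0 \<longleftrightarrow> x = y"
    by (simp add: norm_dist_on_def ell_infty_norm_eq_0 diff)
  assume z: "z \<in> ell_infty"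
  show "norm_dist_on ell_infty ell_infty_norm x z
      \<le> norm_dist_on ell_infty ell_infty_norm x y + norm_dist_on ell_infty ell_infty_norm y z"
    using ell_infty_norm_triangle[OF diff[OF xy] diff[OF xy(2) z]] xy z
    by (simp add: norm_dist_on_def)
qed

lemma closedin_ell_infty_iff:
  "closedin (Metric_space.mtopology ell_infty (norm_dist_on ell_infty ell_infty_norm)) S \<longleftrightarrow>
    S \<subseteq> ell_infty \<and>
    (\<forall>\<sigma> x. range \<sigma> \<subseteq> S \<and> x \<in> ell_infty \<and> (\<lambda>k. ell_infty_norm (\<sigma> k - x)) \<longlonglongrightarrow> 0 \<longrightarrow> x \<in> S)"
proof -
  interpret Metric_space ell_infty "norm_dist_on ell_infty ell_infty_norm"
    by (rule Metric_space_ell_infty)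
  have lim: "limitin mtopology \<sigma> x sequentially \<longleftrightarrow>
      x \<in> ell_infty \<and> (\<lambda>k. ell_infty_norm (\<sigma> k - x)) \<longlonglongrightarrow> 0" if "range \<sigma> \<subseteq> ell_infty" for \<sigma> and x :: "nat \<Rightarrow> 'a"
  proof -
    have "ell_infty_norm (\<sigma> k - x) = norm_dist_on ell_infty ell_infty_norm (\<sigma> k) x"
      if "x \<in> ell_infty" for k
      using \<open>range \<sigma> \<subseteq> ell_infty\<close> that by (auto simp: norm_dist_on_def)
    moreover have "\<forall>\<^sub>F k in sequentially. \<sigma> k \<in> ell_infty"
      using that by (intro always_eventually) auto
    ultimately show ?thesis
      unfolding limitin_metric_dist_null by auto
  qed
  have lim': "range \<sigma> \<subseteq> S \<and> limitin mtopology \<sigma> x sequentially \<longleftrightarrow>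
      range \<sigma> \<subseteq> S \<and> x \<in> ell_infty \<and> (\<lambda>k. ell_infty_norm (\<sigma> k - x)) \<longlonglongrightarrow> 0"
    if "S \<subseteq> ell_infty" for \<sigma> and x :: "nat \<Rightarrow> 'a"
    using lim[of \<sigma> x] that by (meson subset_trans)
  show ?thesis
  proof (cases "S \<subseteq> ell_infty")
    case True
    show ?thesis
      unfolding metric_closedin_iff_sequentially_closed lim'[OF True] ..
  qed (simp add: metric_closedin_iff_sequentially_closed)
qed

lemma sup_in_ell_infty_pointwise:
  fixes x y :: "nat \<Rightarrow> 'g::banach_lattice"
  assumes "x \<in> ell_infty" "y \<in> ell_infty"
  shows "sup_in ell_infty x y z \<longleftrightarrow> z = (\<lambda>n. sup (x n) (y n))"
proof -
  let ?s = "\<lambda>n. sup (x n) (y n)"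
  have "?s \<in> ell_infty"
  proof (rule ell_inftyI)
    fix n
    have "\<bar>sup (x n) (y n)\<bar> \<le> \<bar>x n\<bar> + \<bar>y n\<bar>"
    proof (rule abs_leI)
      show "sup (x n) (y n) \<le> \<bar>x n\<bar> + \<bar>y n\<bar>"
        by (intro le_supI) (simp_all add: abs_ge_self add_increasing add_increasing2)
      have "- sup (x n) (y n) \<le> - x n" by simp
      also have "\<dots> \<le> \<bar>x n\<bar> + \<bar>y n\<bar>" by (simp add: abs_ge_minus_self add_increasing2)
      finally show "- sup (x n) (y n) \<le> \<bar>x n\<bar> + \<bar>y n\<bar>" .
    qed
    then have "norm (sup (x n) (y n)) \<le> norm (\<bar>x n\<bar> + \<bar>y n\<bar>)"
      by (intro norm_abs_mono) simp
    also have "\<dots> \<le> ell_infty_norm x + ell_infty_norm y"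
      using ell_infty_norm_upper[OF assms(1), of n] ell_infty_norm_upper[OF assms(2), of n]
      by (intro norm_triangle_le) simp
    finally show "norm (sup (x n) (y n)) \<le> ell_infty_norm x + ell_infty_norm y" .
  qed
  then have "sup_in ell_infty x y ?s"
    by (auto simp: sup_in_def le_fun_def)
  moreover have "z = ?s" if "sup_in ell_infty x y z"
    using that calculation unfolding sup_in_def by (meson order.antisym)
  ultimately show ?thesis by blast
qed

lemma sup_in_ell_infty_exists:
  "x \<in> ell_infty \<Longrightarrow> y \<in> ell_infty \<Longrightarrow> \<exists>z. sup_in ell_infty x y z"
  for x y :: "nat \<Rightarrow> 'g::banach_lattice"
  by (simp add: sup_in_ell_infty_pointwise)

lemma mcomplete_ell_infty:
  "Metric_space.mcomplete (ell_infty :: (nat \<Rightarrow> 'g::banach) set) (norm_dist_on ell_infty ell_infty_norm)"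
proof -
  interpret Metric_space "ell_infty :: (nat \<Rightarrow> 'g) set" "norm_dist_on ell_infty ell_infty_norm"
    by (rule Metric_space_ell_infty)
  show ?thesis
    unfolding mcomplete_def
  proof (intro allI impI)
    fix \<sigma> :: "nat \<Rightarrow> nat \<Rightarrow> 'g" assume C: "MCauchy \<sigma>"
    then have mem: "\<sigma> k \<in> ell_infty" for k by (auto simp: MCauchy_def)
    have diff: "\<sigma> k - \<sigma> l \<in> ell_infty" for k l
      by (rule subspace_diff[OF subspace_ell_infty mem mem])
    have unif: "\<exists>K. \<forall>k\<ge>K. \<forall>l\<ge>K. \<forall>n. norm (\<sigma> k n - \<sigma> l n) < e" if e: "0 < e" for e
    proof -
      obtain K where K: "\<And>k l. K \<le> k \<Longrightarrow> K \<le> l \<Longrightarrow> norm_dist_on ell_infty ell_infty_norm (\<sigma> k) (\<sigma> l) < e"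
        using conjunct2[OF C[unfolded MCauchy_def], rule_format, OF e] by blast
      have "norm (\<sigma> k n - \<sigma> l n) < e" if "K \<le> k" "K \<le> l" for k l n
        using K[OF that] ell_infty_norm_upper[OF diff, of k l n] mem by (simp add: norm_dist_on_def)
      then show ?thesis by blast
    qed
    have "Cauchy (\<lambda>k. \<sigma> k n)" for n
    proof (rule metric_CauchyI)
      fix e :: real assume "0 < e"
      from unif[OF this] show "\<exists>M. \<forall>k\<ge>M. \<forall>l\<ge>M. dist (\<sigma> k n) (\<sigma> l n) < e"
        unfolding dist_norm by blast
    qed
    then have "\<exists>l. (\<lambda>k. \<sigma> k n) \<longlonglongrightarrow> l" for n
      using Cauchy_convergent convergent_def by blast
    then obtain x where x: "\<And>n. (\<lambda>k. \<sigma> k n) \<longlonglongrightarrow> x n" by metis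
    have lim: "\<exists>K. \<forall>k\<ge>K. \<forall>n. norm (\<sigma> k n - x n) \<le> e" if e: "0 < e" for e
    proof -
      obtain K where K: "\<And>k l n. K \<le> k \<Longrightarrow> K \<le> l \<Longrightarrow> norm (\<sigma> k n - \<sigma> l n) < e"
        using unif[OF e] by blast
      have "norm (\<sigma> k n - x n) \<le> e" if "K \<le> k" for k n
      proof (rule LIMSEQ_le_const2)
        show "(\<lambda>l. norm (\<sigma> k n - \<sigma> l n)) \<longlonglongrightarrow> norm (\<sigma> k n - x n)"
          by (intro tendsto_intros x)
        show "\<exists>N. \<forall>l\<ge>N. norm (\<sigma> k n - \<sigma> l n) \<le> e"
          using K[OF that] less_imp_le by blast
      qed
      then show ?thesis by blast
    qed
    have x_mem: "x \<in> ell_infty"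
    proof -
      obtain K where K: "\<And>n. norm (\<sigma> K n - x n) \<le> 1" using lim[of 1] by auto
      have "norm (x n) \<le> ell_infty_norm (\<sigma> K) + 1" for n
        using norm_triangle_ineq2[of "x n" "\<sigma> K n"] K[of n] ell_infty_norm_upper[OF mem, of K n]
        by (simp add: norm_minus_commute)
      then show ?thesis by (rule ell_inftyI)
    qed
    have "limitin mtopology \<sigma> x sequentially"
      unfolding limit_metric_sequentially
    proof (intro conjI allI impI x_mem)
      fix e :: real assume "0 < e"
      then obtain K where K: "\<And>k n. K \<le> k \<Longrightarrow> norm (\<sigma> k n - x n) \<le> e / 2"
        using lim[of "e / 2"] by auto
      have "ell_infty_norm (\<sigma> k - x) < e" if "K \<le> k" for k
      proof -
        have "ell_infty_norm (\<sigma> k - x) \<le> e / 2"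
          using K[OF that] by (intro ell_infty_norm_least) simp
        then show ?thesis using \<open>0 < e\<close> by simp
      qed
      then show "\<exists>N. \<forall>k\<ge>N. \<sigma> k \<in> ell_infty \<and> norm_dist_on ell_infty ell_infty_norm (\<sigma> k) x < e"
        using mem x_mem by (auto simp: norm_dist_on_def)
    qed
    then show "\<exists>x. limitin mtopology \<sigma> x sequentially" by blast
  qed
qed

theorem banach_sequence_lattice_ell_infty:
  "banach_sequence_lattice (ell_infty :: (nat \<Rightarrow> 'g::banach_lattice) set) ell_infty_norm"
  unfolding banach_sequence_lattice_def
proof (intro conjI ballI allI impI)
  fix x y u v :: "nat \<Rightarrow> 'g"
  assume x: "x \<in> ell_infty" and y: "y \<in> ell_infty"
    and uv: "sup_in ell_infty x (- x) u \<and> sup_in ell_infty y (- y) v \<and> u \<le> v"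
  have "- x \<in> ell_infty" "- y \<in> ell_infty"
    using x y by (auto intro: subspace_neg[OF subspace_ell_infty])
  then have "u = (\<lambda>n. \<bar>x n\<bar>)" "v = (\<lambda>n. \<bar>y n\<bar>)"
    using uv x y by (simp_all add: sup_in_ell_infty_pointwise abs_lattice)
  then have "norm (x n) \<le> norm (y n)" for n
    using uv by (intro norm_abs_mono) (simp add: le_fun_def)
  then show "ell_infty_norm x \<le> ell_infty_norm y"
    using ell_infty_norm_upper[OF y] by (intro ell_infty_norm_least) (meson order_trans)
qed (simp_all add: subspace_ell_infty ell_infty_norm_nonneg ell_infty_norm_eq_0 ell_infty_norm_scaleR
       ell_infty_norm_triangle mcomplete_ell_infty sup_in_ell_infty_exists)

end

theory Submission
  imports Defs
begin

text \<open>
  Let \<open>u\<close> be a positive sequence in one of the three sets.  It fails a null condition: there is a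
  map \<open>p\<close>, the norm or a functional in the bidual, such that \<open>p (u n)\<close> does not tend to zero, and
  \<open>\<bar>p\<bar>\<close> is bounded below by some \<open>e > 0\<close> along a subsequence \<open>x\<close>.  Split the index set into
  infinitely many infinite blocks and let \<open>S\<close> consist of the bounded sequences obtained by
  multiplying \<open>x\<close> by a scalar on each block.

  Since the terms of \<open>x\<close> are positive and nonzero, suprema in \<open>S\<close> amount to maxima of the scalars,
  so \<open>S\<close> is a sublattice; it is closed, because the scalars can be recovered from any single term
  of each block, and infinite dimensional, because there are infinitely many blocks.  With all
  scalars equal to one it contains \<open>x\<close> itself.  A nonzero element of \<open>S\<close> has a nonzero scalar \<open>c\<close> on
  some block, and there \<open>\<bar>p\<bar>\<close> is at least \<open>\<bar>c\<bar> * e\<close> infinitely often, so it fails the same null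
  condition.  On the other hand the convergence and disjointness conditions survive passing to a
  subsequence and multiplying by bounded scalars.  This is
  \<open>block_multiplier_lattice\<close>, and it serves all three sets.

  That the sets lie in \<open>\<ell>\<^sub>\<infinity>(E\<^sup>*)\<close> is the uniform boundedness principle, and that they contain a
  positive sequence is exactly the failure of the property in question.
\<close>

section \<open>Uniform boundedness\<close>

text \<open>
  By Baire's theorem one of the closed sets where all the functionals are bounded by \<open>k\<close> contains a
  ball, and differences of points of that ball reach every direction.
\<close>

lemma dual_uniform_boundedness:
  fixes u :: "nat \<Rightarrow> 'a::banach dual"
  assumes pw: "\<And>z. bounded (range (\<lambda>n. dual_apply (u n) z))"
  shows "bounded (range u)"
proof -
  define F where "F k = {z. \<forall>n. \<bar>dual_apply (u n) z\<bar> \<le> real k}" for k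
  have closed_F: "closed (F k)" for k
    unfolding F_def
    by (intro closed_Collect_all closed_Collect_le continuous_intros
        linear_continuous_on bounded_linear_dual_apply)
  have "z \<in> (\<Union>k. F k)" for z
  proof -
    obtain b where b: "\<And>n. \<bar>dual_apply (u n) z\<bar> \<le> b"
      using pw[of z] by (auto simp: bounded_iff)
    obtain k where "b \<le> real k" using real_arch_simple by blast
    with b have "z \<in> F k" by (auto simp: F_def intro: order_trans)
    then show ?thesis by blast
  qed
  then have UN: "(\<Union>k. F k) = UNIV" by blast
  have "\<exists>k. interior (F k) \<noteq> {}"
  proof (rule ccontr)
    assume "\<not> (\<exists>k. interior (F k) \<noteq> {})"
    then have "(euclidean :: 'a topology) interior_of \<Union>(range F) = {}"
      using closed_F
      by (intro Baire_category_alt) (auto simp: completely_metrizable_space_euclidean)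
    with UN show False by simp
  qed
  then obtain k z0 where "z0 \<in> interior (F k)" by blast
  then obtain e where e: "0 < e" "ball z0 e \<subseteq> F k"
    by (auto simp: mem_interior)
  have "norm (u n) \<le> 4 * real k / e" for n
  proof (rule norm_dual_bound)
    fix z :: 'a
    show "\<bar>dual_apply (u n) z\<bar> \<le> 4 * real k / e * norm z"
    proof (cases "z = 0")
      case False
      define t where "t = e / (2 * norm z)"
      have t: "0 < t" using e False by (simp add: t_def)
      have "norm (t *\<^sub>R z) < e" using e False by (simp add: t_def)
      then have "z0 + t *\<^sub>R z \<in> ball z0 e" "z0 \<in> ball z0 e"
        using e by (simp_all add: dist_norm)
      then have "\<bar>dual_apply (u n) (z0 + t *\<^sub>R z)\<bar> \<le> real k" "\<bar>dual_apply (u n) z0\<bar> \<le> real k"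
        using e(2) unfolding F_def by blast+
      then have "\<bar>t * dual_apply (u n) z\<bar> \<le> 2 * real k" by simp
      then have "t * \<bar>dual_apply (u n) z\<bar> \<le> 2 * real k" using t by (simp add: abs_mult)
      then show ?thesis using e False by (simp add: t_def field_simps)
    qed simp
  qed (use e in simp)
  then show ?thesis by (auto simp: bounded_iff)
qed

lemma weak_star_null_bounded:
  fixes u :: "nat \<Rightarrow> 'a::banach dual"
  assumes "weak_star_null u"
  shows "bounded (range u)"
  using assms
  by (intro dual_uniform_boundedness convergent_imp_bounded) (auto simp: weak_star_null_iff)

lemma abs_dual_apply_le: "\<bar>dual_apply f x\<bar> \<le> dual_apply \<bar>f\<bar> \<bar>x\<bar>" for f :: "'a::banach_lattice dual"
proof -
  have nonneg: "0 \<le> pprt x" "0 \<le> pprt (- x)" by simp_all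
  have "f \<le> \<bar>f\<bar>" "- f \<le> \<bar>f\<bar>" by (simp_all add: abs_ge_self abs_ge_minus_self)
  then have "\<bar>dual_apply f y\<bar> \<le> dual_apply \<bar>f\<bar> y" if "0 \<le> y" for y
    using that by (auto simp: less_eq_dual_def abs_le_iff)
  from this[OF nonneg(1)] this[OF nonneg(2)]
  have "\<bar>dual_apply f (pprt x) - dual_apply f (pprt (- x))\<bar>
      \<le> dual_apply \<bar>f\<bar> (pprt x) + dual_apply \<bar>f\<bar> (pprt (- x))"
    by linarith
  then show ?thesis
    by (metis abs_prts add_uminus_conv_diff dual_apply_linear(2,3) pprt_diff_pprt_neg pprt_neg)
qed

lemma abs_weak_star_null_imp_weak_star_null:
  assumes "abs_weak_star_null u"
  shows "weak_star_null u"
  unfolding weak_star_null_iff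
proof
  fix x
  show "(\<lambda>n. dual_apply (u n) x) \<longlonglongrightarrow> 0"
    by (rule Lim_null_comparison[of _ "\<lambda>n. dual_apply \<bar>u n\<bar> \<bar>x\<bar>"])
      (use assms in \<open>auto simp: abs_weak_star_null_iff abs_dual_apply_le\<close>)
qed


section \<open>Multiples of a positive vector\<close>

lemma sup_scaleR_pos:
  fixes x :: "'a::banach_lattice"
  assumes "0 \<le> x"
  shows "sup (a *\<^sub>R x) (b *\<^sub>R x) = max a b *\<^sub>R x"
proof (cases "a \<le> b")
  case True
  then have "a *\<^sub>R x \<le> b *\<^sub>R x" using assms by (rule scaleR_right_mono)
  then show ?thesis using True by (simp add: sup_absorb2)
next
  case False
  then have "b *\<^sub>R x \<le> a *\<^sub>R x" using assms by (intro scaleR_right_mono) auto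
  then show ?thesis using False by (simp add: sup_absorb1)
qed

lemma abs_scaleR_pos:
  fixes x :: "'a::banach_lattice"
  assumes "0 \<le> x"
  shows "\<bar>c *\<^sub>R x\<bar> = \<bar>c\<bar> *\<^sub>R x"
proof -
  have "\<bar>c *\<^sub>R x\<bar> = sup (c *\<^sub>R x) ((- c) *\<^sub>R x)" by (simp add: abs_lattice)
  also have "\<dots> = max c (- c) *\<^sub>R x" by (rule sup_scaleR_pos[OF assms])
  also have "max c (- c) = \<bar>c\<bar>" by linarith
  finally show ?thesis .
qed

lemma disjoint_scaleR_pos:
  fixes x y :: "'a::banach_lattice"
  assumes xy: "0 \<le> x" "0 \<le> y" "inf x y = 0"
  shows "inf \<bar>c *\<^sub>R x\<bar> \<bar>d *\<^sub>R y\<bar> = 0"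
proof (rule antisym)
  let ?z = "inf \<bar>c *\<^sub>R x\<bar> \<bar>d *\<^sub>R y\<bar>"
  \<comment> \<open>A common positive multiplier for both vectors reduces the claim to homogeneity of \<open>inf\<close>.\<close>
  define t where "t = \<bar>c\<bar> + \<bar>d\<bar> + 1"
  have t: "0 < t" "\<bar>c\<bar> \<le> t" "\<bar>d\<bar> \<le> t" by (auto simp: t_def)
  have "?z \<le> \<bar>c\<bar> *\<^sub>R x" "?z \<le> \<bar>d\<bar> *\<^sub>R y"
    using xy by (simp_all add: abs_scaleR_pos)
  moreover have "\<bar>c\<bar> *\<^sub>R x \<le> t *\<^sub>R x" "\<bar>d\<bar> *\<^sub>R y \<le> t *\<^sub>R y"
    using xy t by (auto intro: scaleR_right_mono)
  ultimately have z: "?z \<le> t *\<^sub>R x" "?z \<le> t *\<^sub>R y" by (meson order_trans)+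
  then have "?z /\<^sub>R t \<le> x" "?z /\<^sub>R t \<le> y"
    using t by (simp_all add: pos_divideR_le_eq)
  then have "?z /\<^sub>R t \<le> inf x y" by (rule le_infI)
  then show "?z \<le> 0" using xy t by (simp add: pos_divideR_le_eq)
qed simp


section \<open>The lattice of block multipliers\<close>

text \<open>
  The blocks are the rows of the pairing function, that is, the fibres of this map.
\<close>

definition block :: "nat \<Rightarrow> nat"
  where "block j = fst (prod_decode j)"

lemma block_unbounded: "\<exists>j\<ge>N. block j = m"
  by (rule exI[of _ "prod_encode (m, N)"]) (simp add: block_def le_prod_encode_2)

definition block_multiples :: "(nat \<Rightarrow> 'g::banach_lattice) \<Rightarrow> (nat \<Rightarrow> 'g) set"
  where "block_multiples x = {v \<in> ell_infty. \<exists>a. v = (\<lambda>j. a (block j) *\<^sub>R x j)}"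

lemma closed_infinite_dim_sublattice_block_multiples:
  fixes x :: "nat \<Rightarrow> 'g::banach_lattice"
  assumes bdd: "x \<in> ell_infty" and pos: "\<And>j. 0 \<le> x j" and nz: "\<And>j. x j \<noteq> 0"
  shows "closed_infinite_dim_sublattice ell_infty ell_infty_norm (block_multiples x)"
    (is "closed_infinite_dim_sublattice _ _ ?S")
  unfolding closed_infinite_dim_sublattice_def
proof (intro conjI)
  show "?S \<subseteq> ell_infty" by (auto simp: block_multiples_def)
  show "subspace ?S"
  proof (rule subspaceI)
    show "0 \<in> ?S"
      by (auto simp: block_multiples_def subspace_0[OF subspace_ell_infty] fun_eq_iff
          intro!: exI[of _ "\<lambda>_. 0"])
    fix v w :: "nat \<Rightarrow> 'g" and c :: real
    assume v: "v \<in> ?S"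
    then obtain a where a: "v = (\<lambda>j. a (block j) *\<^sub>R x j)" by (auto simp: block_multiples_def)
    have "c *\<^sub>R v = (\<lambda>j. (c * a (block j)) *\<^sub>R x j)"
      by (simp add: a scaleR_fun_def)
    moreover have "c *\<^sub>R v \<in> ell_infty"
      using v by (auto simp: block_multiples_def intro: subspace_scale[OF subspace_ell_infty])
    ultimately show "c *\<^sub>R v \<in> ?S"
      by (auto simp: block_multiples_def intro!: exI[of _ "\<lambda>m. c * a m"])
    assume w: "w \<in> ?S"
    then obtain b where b: "w = (\<lambda>j. b (block j) *\<^sub>R x j)" by (auto simp: block_multiples_def)
    have "v + w = (\<lambda>j. (a (block j) + b (block j)) *\<^sub>R x j)"
      by (auto simp: a b fun_eq_iff scaleR_add_left)
    moreover have "v + w \<in> ell_infty"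
      using v w by (auto simp: block_multiples_def intro: subspace_add[OF subspace_ell_infty])
    ultimately show "v + w \<in> ?S"
      by (auto simp: block_multiples_def intro!: exI[of _ "\<lambda>m. a m + b m"])
  qed
  show "\<forall>v\<in>?S. \<forall>w\<in>?S. \<exists>z\<in>?S. sup_in ell_infty v w z"
  proof (intro ballI)
    fix v w assume vw: "v \<in> ?S" "w \<in> ?S"
    then obtain a b where ab: "v = (\<lambda>j. a (block j) *\<^sub>R x j)" "w = (\<lambda>j. b (block j) *\<^sub>R x j)"
      by (auto simp: block_multiples_def)
    let ?z = "\<lambda>j. sup (v j) (w j)"
    have s: "sup_in ell_infty v w ?z"
      using vw by (subst sup_in_ell_infty_pointwise) (auto simp: block_multiples_def)
    then have "?z \<in> ell_infty" by (simp add: sup_in_def)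
    moreover have "?z = (\<lambda>j. max (a (block j)) (b (block j)) *\<^sub>R x j)"
      by (simp add: ab sup_scaleR_pos pos)
    ultimately have "?z \<in> ?S"
      by (auto simp: block_multiples_def intro!: exI[of _ "\<lambda>m. max (a m) (b m)"])
    with s show "\<exists>z\<in>?S. sup_in ell_infty v w z" by blast
  qed
  show "closedin (Metric_space.mtopology ell_infty (norm_dist_on ell_infty ell_infty_norm)) ?S"
    unfolding closedin_ell_infty_iff
  proof (intro conjI allI impI; (elim conjE)?)
    show "?S \<subseteq> ell_infty" by (auto simp: block_multiples_def)
    fix \<sigma> v
    assume \<sigma>: "range \<sigma> \<subseteq> ?S" and v: "v \<in> ell_infty"
      and lim: "(\<lambda>k. ell_infty_norm (\<sigma> k - v)) \<longlonglongrightarrow> 0"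
    have "\<exists>a. \<sigma> k = (\<lambda>j. a (block j) *\<^sub>R x j)" for k
      using \<sigma> by (auto simp: block_multiples_def)
    then obtain A where A: "\<And>k. \<sigma> k = (\<lambda>j. A k (block j) *\<^sub>R x j)" by metis
    have pw: "(\<lambda>k. \<sigma> k j) \<longlonglongrightarrow> v j" for j
    proof (rule LIM_zero_cancel, rule Lim_null_comparison[OF _ lim], rule always_eventually, rule allI)
      fix k
      have "\<sigma> k - v \<in> ell_infty"
        using \<sigma> v by (auto simp: block_multiples_def intro!: subspace_diff[OF subspace_ell_infty])
      from ell_infty_norm_upper[OF this, of j]
      show "norm (\<sigma> k j - v j) \<le> ell_infty_norm (\<sigma> k - v)" by simp
    qed
    \<comment> \<open>One term of each block determines the limit of the scalars on that block, because the
      multiples of a nonzero vector form a closed set on which the scalar depends continuously.\<close>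
    have "\<exists>l. (\<lambda>k. A k m) \<longlonglongrightarrow> l" for m
    proof -
      obtain j where j: "block j = m" using block_unbounded[of 0 m] by blast
      have "Cauchy (\<lambda>k. \<sigma> k j)" by (rule LIMSEQ_imp_Cauchy[OF pw])
      have "Cauchy (\<lambda>k. A k m)"
      proof (rule metric_CauchyI)
        fix e :: real assume "0 < e"
        then have "0 < e * norm (x j)" using nz by simp
        from metric_CauchyD[OF \<open>Cauchy (\<lambda>k. \<sigma> k j)\<close> this]
        obtain M where M: "\<And>k l. k \<ge> M \<Longrightarrow> l \<ge> M \<Longrightarrow> dist (\<sigma> k j) (\<sigma> l j) < e * norm (x j)" by blast
        have "dist (A k m) (A l m) < e" if "k \<ge> M" "l \<ge> M" for k l
          using M[OF that] nz[of j]
          by (simp add: A j dist_norm scaleR_diff_left[symmetric] del: scaleR_diff_left)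
        then show "\<exists>M. \<forall>k\<ge>M. \<forall>l\<ge>M. dist (A k m) (A l m) < e" by blast
      qed
      then show ?thesis using Cauchy_convergent convergent_def by blast
    qed
    then obtain a where a: "\<And>m. (\<lambda>k. A k m) \<longlonglongrightarrow> a m" by metis
    have "(\<lambda>k. \<sigma> k j) \<longlonglongrightarrow> a (block j) *\<^sub>R x j" for j
      unfolding A by (intro tendsto_intros a)
    then have "v = (\<lambda>j. a (block j) *\<^sub>R x j)"
      using pw LIMSEQ_unique by blast
    then show "v \<in> ?S" using v by (auto simp: block_multiples_def)
  qed
  show "\<not> (\<exists>F. finite F \<and> ?S \<subseteq> span F)"
  proof
    assume "\<exists>F. finite F \<and> ?S \<subseteq> span F"
    then obtain F where F: "finite F" "?S \<subseteq> span F" by blast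
    define e where "e m = (\<lambda>j. (if block j = m then 1 else 0) *\<^sub>R x j)" for m
    obtain J where J: "\<And>m. block (J m) = m" using block_unbounded[of 0] by metis
    have e_J: "e m (J n) = 0 \<longleftrightarrow> n \<noteq> m" for m n by (simp add: e_def J nz)
    have "e m \<in> ell_infty" for m
      using ell_infty_norm_upper[OF bdd] ell_infty_norm_nonneg[OF bdd]
      by (intro ell_inftyI[of _ "ell_infty_norm x"]) (simp add: e_def)
    then have e_S: "range e \<subseteq> ?S"
      by (auto simp: block_multiples_def e_def intro!: exI[of _ "\<lambda>n. if n = _ then 1 else 0"])
    have inj: "inj e" using e_J by (metis injI)
    have "independent (range e)"
      unfolding dependent_def
    proof (clarsimp)
      fix m assume m: "e m \<in> span (range e - {e m})"
      \<comment> \<open>All other block indicators vanish at \<open>J m\<close>, hence so does their span.\<close>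
      have "span (range e - {e m}) \<subseteq> {v. v (J m) = 0}"
        by (rule span_minimal) (auto simp: subspace_def scaleR_fun_def e_J)
      with m have "e m (J m) = 0" by blast
      then show False by (simp add: e_J)
    qed
    then have "finite (range e)"
      using independent_span_bound[OF F(1)] e_S F(2) by (meson subset_trans)
    then show False using inj by (simp add: finite_image_iff)
  qed
qed

text \<open>
  The map \<open>p\<close> is a detector for sequences that are not null: the norm, or a functional.  Absolute
  homogeneity carries its lower bound along the subsequence over to every nonzero block multiple,
  and continuity at the origin turns this lower bound into one for the norms, which forces the
  scalars of a bounded block multiple to be bounded.
\<close>

lemma block_multiplier_lattice:
  fixes u :: "nat \<Rightarrow> 'g::banach_lattice" and p :: "'g \<Rightarrow> real"
  assumes bdd: "bounded (range u)" and pos: "\<And>n. 0 \<le> u n"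
    and hom: "\<And>c z. \<bar>p (c *\<^sub>R z)\<bar> = \<bar>c\<bar> * \<bar>p z\<bar>"
    and bound: "\<And>z. \<bar>p z\<bar> \<le> K * norm z"
    and not_null: "\<not> (\<lambda>n. p (u n)) \<longlonglongrightarrow> 0"
  shows "\<exists>S r. closed_infinite_dim_sublattice ell_infty ell_infty_norm S \<and>
    strict_mono (r :: nat \<Rightarrow> nat) \<and> u \<circ> r \<in> S \<and>
    (\<forall>v\<in>S. \<exists>c. bounded (range c) \<and> v = (\<lambda>n. c n *\<^sub>R u (r n)) \<and>
      (v = 0 \<or> \<not> (\<lambda>n. p (v n)) \<longlonglongrightarrow> 0))"
proof -
  obtain e where e: "0 < e" "\<And>N. \<exists>n\<ge>N. e \<le> \<bar>p (u n)\<bar>"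
    using not_null by (auto simp: lim_sequentially not_less)
  then have "infinite {n. e \<le> \<bar>p (u n)\<bar>}"
    unfolding infinite_nat_iff_unbounded_le by blast
  then obtain r :: "nat \<Rightarrow> nat" where r: "strict_mono r" "\<And>n. e \<le> \<bar>p (u (r n))\<bar>"
    using infinite_enumerate by blast
  define x where "x = u \<circ> r"
  have p0: "p 0 = 0" using hom[of 0 0] by simp
  have nz: "x j \<noteq> 0" for j using r(2)[of j] e(1) p0 by (auto simp: x_def)
  have x_bdd: "x \<in> ell_infty"
    using bdd by (auto simp: x_def ell_infty_def elim: bounded_subset)
  have S: "closed_infinite_dim_sublattice ell_infty ell_infty_norm (block_multiples x)"
    by (rule closed_infinite_dim_sublattice_block_multiples) (auto simp: x_bdd nz, simp add: x_def pos)
  have x_S: "x \<in> block_multiples x"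
    using x_bdd by (auto simp: block_multiples_def intro!: exI[of _ "\<lambda>_. 1"])
  have "\<exists>c. bounded (range c) \<and> v = (\<lambda>n. c n *\<^sub>R u (r n)) \<and>
      (v = 0 \<or> \<not> (\<lambda>n. p (v n)) \<longlonglongrightarrow> 0)" if v: "v \<in> block_multiples x" for v
  proof -
    obtain a where a: "v = (\<lambda>j. a (block j) *\<^sub>R x j)" and v_bdd: "v \<in> ell_infty"
      using v by (auto simp: block_multiples_def)
    obtain b where b: "\<And>n. norm (v n) \<le> b" using ell_infty_norm_upper[OF v_bdd] by blast
    have p_v: "\<bar>a (block n)\<bar> * e \<le> \<bar>p (v n)\<bar>" for n
      using mult_left_mono[OF r(2)[of n], of "\<bar>a (block n)\<bar>"] by (simp add: a x_def hom)
    have "\<bar>a (block n)\<bar> \<le> \<bar>K\<bar> * b / e" for n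
    proof -
      have "\<bar>a (block n)\<bar> * e \<le> K * norm (v n)"
        using p_v[of n] bound[of "v n"] by linarith
      also have "\<dots> \<le> \<bar>K\<bar> * b" using b[of n] by (intro mult_mono) auto
      finally show ?thesis using e(1) by (simp add: field_simps)
    qed
    then have "bounded (range (\<lambda>n. a (block n)))" by (auto simp: bounded_iff)
    moreover have "\<not> (\<lambda>n. p (v n)) \<longlonglongrightarrow> 0" if v_nz: "v \<noteq> 0"
    proof
      obtain i where i: "a (block i) \<noteq> 0"
        using v_nz unfolding a fun_eq_iff by (metis scaleR_zero_left zero_fun_apply)
      then have "0 < \<bar>a (block i)\<bar> * e" using e(1) by simp
      moreover assume "(\<lambda>n. p (v n)) \<longlonglongrightarrow> 0"
      ultimately obtain N where "\<And>n. n \<ge> N \<Longrightarrow> \<bar>p (v n)\<bar> < \<bar>a (block i)\<bar> * e"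
        by (force simp: lim_sequentially)
      \<comment> \<open>The block of \<open>i\<close> has indices beyond \<open>N\<close>, and \<open>v\<close> has the same scalar there.\<close>
      moreover obtain n where "n \<ge> N" "block n = block i" using block_unbounded by blast
      ultimately show False using p_v[of n] by fastforce
    qed
    ultimately show ?thesis using a by (auto simp: x_def)
  qed
  then show ?thesis using S x_S r(1) unfolding x_def by blast
qed

text \<open>
  What remains to be checked for a concrete set of sequences: its membership condition is the
  conjunction of a property \<open>Q\<close>, which bounded multiples of subsequences of positive sequences
  inherit, and the existence of a detector.  The detector is chosen for the given positive sequence
  and then serves for the whole lattice built from it.
\<close>

lemma almost_positive_pointwise_latticeable_detectors:
  fixes Q :: "(nat \<Rightarrow> 'g::banach_lattice) \<Rightarrow> bool" and P :: "('g \<Rightarrow> real) set"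
  assumes bdd: "\<And>u. Q u \<Longrightarrow> bounded (range u)"
    and inherit: "\<And>u r c. Q u \<Longrightarrow> 0 \<le> u \<Longrightarrow> strict_mono (r :: nat \<Rightarrow> nat) \<Longrightarrow> bounded (range c) \<Longrightarrow>
      Q (\<lambda>n. c n *\<^sub>R u (r n))"
    and hom: "\<And>p c z. p \<in> P \<Longrightarrow> \<bar>p (c *\<^sub>R z)\<bar> = \<bar>c\<bar> * \<bar>p z\<bar>"
    and bound: "\<And>p. p \<in> P \<Longrightarrow> \<exists>K. \<forall>z. \<bar>p z\<bar> \<le> K * norm z"
    and B: "\<And>u. u \<in> B \<longleftrightarrow> Q u \<and> (\<exists>p\<in>P. \<not> (\<lambda>n. p (u n)) \<longlonglongrightarrow> 0)"
    and positive: "\<exists>u\<in>B. 0 \<le> u"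
  shows "almost_positive_pointwise_latticeable ell_infty ell_infty_norm B"
  unfolding almost_positive_pointwise_latticeable_def
proof (intro conjI ballI impI)
  show B_bdd: "B \<subseteq> ell_infty" using B bdd by (auto simp: ell_infty_def)
  then show "B \<inter> {x \<in> ell_infty. 0 \<le> x} \<noteq> {}" using positive by blast
  fix u assume u: "u \<in> B" "0 \<le> u"
  then obtain p where Q: "Q u" and p: "p \<in> P" "\<not> (\<lambda>n. p (u n)) \<longlonglongrightarrow> 0" using B by blast
  obtain K where K: "\<And>z. \<bar>p z\<bar> \<le> K * norm z" using bound[OF p(1)] by blast
  have pos: "0 \<le> u n" for n using u(2) by (simp add: le_fun_def)
  obtain S r where S: "closed_infinite_dim_sublattice ell_infty ell_infty_norm S"
    and r: "strict_mono (r :: nat \<Rightarrow> nat)" "u \<circ> r \<in> S"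
    and mult: "\<And>v. v \<in> S \<Longrightarrow> \<exists>c. bounded (range c) \<and> v = (\<lambda>n. c n *\<^sub>R u (r n)) \<and>
      (v = 0 \<or> \<not> (\<lambda>n. p (v n)) \<longlonglongrightarrow> 0)"
    using block_multiplier_lattice[OF bdd[OF Q] pos hom[OF p(1)] K p(2)] by blast
  have "v \<in> B \<union> {0}" if v: "v \<in> S" for v
  proof -
    obtain c where c: "bounded (range c)" "v = (\<lambda>n. c n *\<^sub>R u (r n))"
      "v = 0 \<or> \<not> (\<lambda>n. p (v n)) \<longlonglongrightarrow> 0"
      using mult[OF v] by blast
    have "Q v" using inherit[OF Q u(2) r(1) c(1)] c(2) by simp
    then show ?thesis using c(3) p(1) B by blast
  qed
  then show "\<exists>S. closed_infinite_dim_sublattice ell_infty ell_infty_norm S \<and> S \<subseteq> B \<union> {0} \<and>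
      (\<exists>r :: nat \<Rightarrow> nat. strict_mono r \<and> u \<circ> r \<in> S)"
    using S r by blast
qed


section \<open>Bounded multiples of subsequences\<close>

lemma tendsto_zero_mult_subseq:
  fixes f c :: "nat \<Rightarrow> real"
  assumes "f \<longlonglongrightarrow> 0" "strict_mono r" "bounded (range c)"
  shows "(\<lambda>n. c n * f (r n)) \<longlonglongrightarrow> 0"
proof -
  obtain b where b: "\<And>n. \<bar>c n\<bar> \<le> b" using assms(3) by (auto simp: bounded_iff)
  have "(\<lambda>n. f (r n)) \<longlonglongrightarrow> 0"
    using LIMSEQ_subseq_LIMSEQ[OF assms(1,2)] by (simp add: o_def)
  then have "(\<lambda>n. b * \<bar>f (r n)\<bar>) \<longlonglongrightarrow> 0" by (intro tendsto_mult_right_zero tendsto_rabs_zero)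
  then show ?thesis
    by (rule Lim_null_comparison[rotated]) (simp add: abs_mult b mult_right_mono)
qed

lemma weak_star_null_multiples:
  assumes "weak_star_null u" "strict_mono r" "bounded (range c)"
  shows "weak_star_null (\<lambda>n. c n *\<^sub>R u (r n))"
  using assms tendsto_zero_mult_subseq[of "\<lambda>n. dual_apply (u n) _"] by (simp add: weak_star_null_iff)

lemma abs_weak_star_null_multiples:
  assumes "abs_weak_star_null u" "0 \<le> u" "strict_mono r" "bounded (range c)"
  shows "abs_weak_star_null (\<lambda>n. c n *\<^sub>R u (r n))"
proof -
  have pos: "0 \<le> u n" for n using assms(2) by (simp add: le_fun_def)
  have "bounded (range (\<lambda>n. \<bar>c n\<bar>))" using assms(4) by (simp add: bounded_iff)
  then show ?thesis
    using assms(1,3) tendsto_zero_mult_subseq[of "\<lambda>n. dual_apply (u n) \<bar>_\<bar>" r "\<lambda>n. \<bar>c n\<bar>"]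
    by (simp add: abs_weak_star_null_iff abs_scaleR_pos pos)
qed

lemma disjoint_seq_multiples:
  assumes "disjoint_seq u" "0 \<le> u" "strict_mono r"
  shows "disjoint_seq (\<lambda>n. c n *\<^sub>R u (r n))"
proof -
  have pos: "0 \<le> u n" for n using assms(2) by (simp add: le_fun_def)
  have "inf (u (r j)) (u (r k)) = 0" if "j \<noteq> k" for j k
    using assms(1) that strict_mono_eq[OF assms(3)] pos by (auto simp: disjoint_seq_def)
  then show ?thesis by (auto simp: disjoint_seq_def intro!: disjoint_scaleR_pos pos)
qed


section \<open>The three sets\<close>

lemma latticeable_weak_star_null_not_weakly_null:
  assumes "\<not> positive_Grothendieck_property TYPE('e::banach_lattice)"
  shows "almost_positive_pointwise_latticeable ell_infty ell_infty_norm
    {u :: nat \<Rightarrow> 'e dual. weak_star_null u \<and> \<not> weakly_null u}"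
proof (rule almost_positive_pointwise_latticeable_detectors[where Q = weak_star_null and P = "range dual_apply"])
  show "\<exists>u \<in> {u :: nat \<Rightarrow> 'e dual. weak_star_null u \<and> \<not> weakly_null u}. 0 \<le> u"
    using assms by (auto simp: positive_Grothendieck_property_def le_fun_def)
  show "\<exists>K. \<forall>z. \<bar>p z\<bar> \<le> K * norm z" if "p \<in> range dual_apply" for p :: "'e dual \<Rightarrow> real"
    using that dual_apply_le_norm by blast
qed (auto simp: weak_star_null_bounded weak_star_null_multiples weakly_null_iff abs_mult)

text \<open>
  The norm is the detector here.  The condition \<open>W\<close> stands for \<open>weak_star_null\<close> or
  \<open>abs_weak_star_null\<close>, which agree on positive sequences, because \<open>\<bar>u n\<bar> = u n\<close> there.
\<close>

lemma latticeable_disjoint_not_norm_null: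
  fixes W :: "(nat \<Rightarrow> 'e::banach_lattice dual) \<Rightarrow> bool"
  assumes fails: "\<not> dual_positive_Schur_property TYPE('e)"
    and weak_star: "\<And>u. W u \<Longrightarrow> weak_star_null u"
    and on_positive: "\<And>u. weak_star_null u \<Longrightarrow> 0 \<le> u \<Longrightarrow> W u"
    and multiples: "\<And>u r c. W u \<Longrightarrow> 0 \<le> u \<Longrightarrow> strict_mono r \<Longrightarrow> bounded (range c) \<Longrightarrow>
      W (\<lambda>n. c n *\<^sub>R u (r n))"
  shows "almost_positive_pointwise_latticeable ell_infty ell_infty_norm
    {u. W u \<and> disjoint_seq u \<and> \<not> norm_null u}"
proof (rule almost_positive_pointwise_latticeable_detectors
    [where Q = "\<lambda>u. W u \<and> disjoint_seq u" and P = "{norm}"])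
  obtain u :: "nat \<Rightarrow> 'e dual"
    where "0 \<le> u" "disjoint_seq u" "weak_star_null u" "\<not> norm_null u"
    using fails by (auto simp: dual_positive_Schur_property_def le_fun_def)
  then show "\<exists>u \<in> {u. W u \<and> disjoint_seq u \<and> \<not> norm_null u}. 0 \<le> u"
    using on_positive by blast
  show "\<exists>K. \<forall>z. \<bar>p z\<bar> \<le> K * norm z" if "p \<in> {norm}" for p :: "'e dual \<Rightarrow> real"
    using that by (intro exI[of _ 1]) simp
qed (auto simp: weak_star weak_star_null_bounded multiples disjoint_seq_multiples
    norm_null_def tendsto_norm_zero_iff)

theorem corollary4p11:
  shows
    "(\<not> positive_Grothendieck_property TYPE('e::banach_lattice) \<longrightarrow>
        almost_positive_pointwise_latticeable ell_infty ell_infty_norm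
          {u :: nat \<Rightarrow> 'e dual. weak_star_null u \<and> \<not> weakly_null u})
     \<and>
     (\<not> dual_positive_Schur_property TYPE('e) \<longrightarrow>
        almost_positive_pointwise_latticeable ell_infty ell_infty_norm
          {u :: nat \<Rightarrow> 'e dual. weak_star_null u \<and> disjoint_seq u \<and> \<not> norm_null u}
        \<and>
        almost_positive_pointwise_latticeable ell_infty ell_infty_norm
          {u :: nat \<Rightarrow> 'e dual. abs_weak_star_null u \<and> disjoint_seq u \<and> \<not> norm_null u})"
proof (intro conjI impI)
  assume "\<not> positive_Grothendieck_property TYPE('e)"
  then show "almost_positive_pointwise_latticeable ell_infty ell_infty_norm
      {u :: nat \<Rightarrow> 'e dual. weak_star_null u \<and> \<not> weakly_null u}"
    by (rule latticeable_weak_star_null_not_weakly_null)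
next
  assume fails: "\<not> dual_positive_Schur_property TYPE('e)"
  show "almost_positive_pointwise_latticeable ell_infty ell_infty_norm
      {u :: nat \<Rightarrow> 'e dual. weak_star_null u \<and> disjoint_seq u \<and> \<not> norm_null u}"
    by (rule latticeable_disjoint_not_norm_null[OF fails]) (simp_all add: weak_star_null_multiples)
  have "abs_weak_star_null u" if "weak_star_null u" "0 \<le> u" for u :: "nat \<Rightarrow> 'e dual"
    using that by (simp add: weak_star_null_iff abs_weak_star_null_iff le_fun_def)
  then show "almost_positive_pointwise_latticeable ell_infty ell_infty_norm
      {u :: nat \<Rightarrow> 'e dual. abs_weak_star_null u \<and> disjoint_seq u \<and> \<not> norm_null u}"
    by (intro latticeable_disjoint_not_norm_null[OF fails])
      (simp_all add: abs_weak_star_null_imp_weak_star_null abs_weak_star_null_multiples)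
qed

end
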